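(* Let $\{B_n(x)\}_{n=0}^\infty$ be a sequence in $\mathbb{R}[x]$ with $\deg(B_n(x))=n$ for every $n\in\mathbb{N}_0$ (and $B_0(x)\not\equiv 0$), let $\{a_n\}_{n=0}^\infty$ be a sequence of real numbers, and let $\{Q_k(x)\}_{k=0}^\infty$ be a sequence in $\mathbb{R}[x]$ such that the linear operator $T=\sum_{k=0}^\infty Q_k(x)D^k:\mathbb{R}[x]\to\mathbb{R}[x]$ is hyperbolicity preserving and satisfies $$T[B_n(x)]=\left(\sum_{k=0}^\infty Q_k(x)D^k\right)B_n(x)=a_nB_n(x)\quad\text{for every } n\in\mathbb{N}_0 ,$$ where $0<a_n<a_{n+1}$ for each $n\in\mathbb{N}_0$. If $\{a_n\}_{n=0}^\infty$ is interpolated by a polynomial $p(x)$ with $\deg(p(x))=m$, then $\deg(Q_k(x))=k$ for all $0\le k\le m$. Likewise, if $\{a_n\}_{n=0}^\infty$ cannot be interpolated by a polynomial, then $\deg(Q_k(x))=k$ for every $k\in\mathbb{N}_0$.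
   Context: $\mathbb{N}_0=\{0,1,2,\dots\}$ and $D=\frac{d}{dx}$. The operator $\sum_{k=0}^\infty Q_k(x)D^k$ acts on $p\in\mathbb{R}[x]$ by $p\mapsto\sum_{k=0}^{\infty}Q_k(x)p^{(k)}(x)$, a finite sum since $p^{(k)}=0$ for $k>\deg p$. A linear operator $T:\mathbb{R}[x]\to\mathbb{R}[x]$ is hyperbolicity preserving if $T[p(x)]$ has only real zeros whenever $p(x)\in\mathbb{R}[x]$ has only real zeros; here nonzero constants, and by convention the zero polynomial, count as having only real zeros. A sequence of real numbers $\{a_n\}_{n=0}^\infty$ is interpolated by a polynomial $p(x)$ if $a_n=p(n)$ for every $n\in\mathbb{N}_0$; if there is no such polynomial, it cannot be interpolated by a polynomial. The zero polynomial has degree $-\infty$. *)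

theory Defs
  imports Complex_Main "HOL-Computational_Algebra.Polynomial"
begin

text \<open>
  The library sets \<open>degree 0 = 0\<close>. Here the zero polynomial has degree minus infinity,
  so it must not count as a polynomial of degree 0.
\<close>
definition has_degree :: "'a::zero poly \<Rightarrow> nat \<Rightarrow> bool" where
  "has_degree p n \<longleftrightarrow> p \<noteq> 0 \<and> degree p = n"

text \<open>
  Zeros are taken in the complex numbers, so the coefficients are first embedded there.
  Nonzero constants satisfy the second disjunct vacuously; the zero polynomial is
  included by convention.
\<close>
definition only_real_zeros :: "real poly \<Rightarrow> bool" where
  "only_real_zeros p \<longleftrightarrow>
     p = 0 \<or> (\<forall>z::complex. poly (map_poly of_real p) z = 0 \<longrightarrow> z \<in> \<real>)"

text \<open>Used only for linear maps; for the operators below see \<open>linear_diff_op\<close>.\<close>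
definition hyperbolicity_preserving :: "(real poly \<Rightarrow> real poly) \<Rightarrow> bool" where
  "hyperbolicity_preserving T \<longleftrightarrow> (\<forall>p. only_real_zeros p \<longrightarrow> only_real_zeros (T p))"

text \<open>
  The formal series \<open>\<Sum>k. Q k * D^k\<close>. All terms with \<open>k > degree p\<close> vanish, so cutting
  the sum off at \<open>degree p\<close> loses nothing; see \<open>diff_op_eq_sum\<close>.
\<close>
definition diff_op :: "(nat \<Rightarrow> real poly) \<Rightarrow> real poly \<Rightarrow> real poly" where
  "diff_op Q p = (\<Sum>k\<le>degree p. Q k * (pderiv ^^ k) p)"

definition interpolated_by :: "(nat \<Rightarrow> real) \<Rightarrow> real poly \<Rightarrow> bool" where
  "interpolated_by a p \<longleftrightarrow> (\<forall>n. a n = poly p (of_nat n))"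

lemma higher_pderiv_eq_0:
  fixes p :: "real poly"
  assumes "degree p < k"
  shows "(pderiv ^^ k) p = 0"
  using assms
proof (induction k arbitrary: p)
  case (Suc k)
  show ?case
  proof (cases "degree p = 0")
    case True
    then have "pderiv p = 0" by (simp add: pderiv_eq_0_iff)
    moreover have "(pderiv ^^ j) (0 :: real poly) = 0" for j by (induction j) simp_all
    ultimately show ?thesis by (simp del: funpow.simps add: funpow_Suc_right)
  next
    case False
    then have "degree (pderiv p) < k" using Suc.prems by (simp add: degree_pderiv)
    then show ?thesis using Suc.IH by (simp del: funpow.simps add: funpow_Suc_right)
  qed
qed simp

lemma diff_op_eq_sum:
  assumes "degree p \<le> N"
  shows "diff_op Q p = (\<Sum>k\<le>N. Q k * (pderiv ^^ k) p)"
  unfolding diff_op_def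
  by (rule sum.mono_neutral_left) (use assms in \<open>auto simp: higher_pderiv_eq_0\<close>)

lemma linear_diff_op: "Vector_Spaces.linear smult smult (diff_op Q)"
proof -
  have vs: "vector_space (smult :: real \<Rightarrow> real poly \<Rightarrow> real poly)"
    by unfold_locales (simp_all add: smult_add_right smult_add_left)
  have add: "(pderiv ^^ k) (p + q) = (pderiv ^^ k) p + (pderiv ^^ k) q"
    for k and p q :: "real poly"
    by (induction k) (simp_all add: pderiv_add)
  have smult: "(pderiv ^^ k) (smult c p) = smult c ((pderiv ^^ k) p)"
    for k c and p :: "real poly"
    by (induction k) (simp_all add: pderiv_smult)
  have "diff_op Q (p + q) = diff_op Q p + diff_op Q q" for p q
    using diff_op_eq_sum[of p "max (degree p) (degree q)" Q]
      diff_op_eq_sum[of q "max (degree p) (degree q)" Q]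
      diff_op_eq_sum[OF degree_add_le_max, of Q p q]
    by (simp add: add distrib_left sum.distrib)
  moreover have "smult c (sum f A) = (\<Sum>k\<in>A. smult c (f k))"
    for c and f :: "nat \<Rightarrow> real poly" and A
    by (induction A rule: infinite_finite_induct) (simp_all add: smult_add_right)
  then have "diff_op Q (smult c p) = smult c (diff_op Q p)" for c p
    using diff_op_eq_sum[OF degree_smult_le, of Q c p]
    by (simp add: diff_op_def smult)
  ultimately show ?thesis
    using vs by (simp add: Vector_Spaces.linear_iff vector_space_pair_def)
qed

end

theory Submission
  imports Defs "HOL-Computational_Algebra.Fundamental_Theorem_Algebra"
begin

text \<open>
  Since \<open>T\<close> has an eigenvector of each degree, it is triangular on the monomials, with diagonal
  \<open>a\<close>. Hence \<open>degree (Q k) \<le> k\<close>, and by Newton's forward difference formula the coefficient of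
  \<open>x ^ k\<close> in \<open>Q k\<close> is the \<open>k\<close>-th difference of \<open>a\<close> at \<open>0\<close>, divided by \<open>k!\<close>
  (\<open>triangular_coeffs\<close>). So the question is when the \<open>k\<close>-th difference of \<open>a\<close> at \<open>0\<close> can
  vanish. It does so only if the \<open>k\<close>-th differences vanish at every place; then Newton's formula
  interpolates \<open>a\<close> by a polynomial of degree less than \<open>k\<close>, which is the only interpolating one.

  The dichotomy comes from real zeros. Under rescaling of the variable \<open>T\<close> tends to its diagonal
  part, so all Jensen polynomials \<open>\<Sum>k\<le>n. (n choose k) * a k * x ^ k\<close> have only real zeros
  (\<open>triangular_hyperbolic_imp_jensen\<close>). This property passes to shifted sequences, by
  differentiation, and to the sequence \<open>k \<longmapsto> (fdiff ^^ k) a 0\<close>, by a Moebius substitution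
  (\<open>jensen_hyperbolic_differences\<close>). Hence it holds for the differences of any order at any place.

  The Jensen polynomials of degrees 2 and 3 now give a log-concavity inequality and a cubic
  discriminant inequality for the differences. These suffice to show by induction on \<open>k\<close> that
  the \<open>k\<close>-th differences either all vanish or are all positive and nondecreasing
  (\<open>fdiff_pos_mono_or_zero\<close>). In analytic terms, the exponential generating function
  of \<open>a\<close> is a positive constant times \<open>exp (\<sigma> x)\<close> times a product of factors \<open>1 + \<rho> x\<close> with
  \<open>\<rho> > 0\<close>, monotonicity of \<open>a\<close> means \<open>\<sigma> \<ge> 1\<close>, and multiplication by \<open>exp (- x)\<close> turns it into
  the exponential generating function of the differences, whose coefficients are then visibly
  nonnegative; the inequalities replace this appeal to the theory of entire functions.
\<close>

section \<open>Polynomials with only real zeros\<close>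

abbreviation cpoly :: "real poly \<Rightarrow> complex \<Rightarrow> complex" where
  "cpoly p z \<equiv> poly (map_poly of_real p) z"

lemma cpoly_pCons: "cpoly (pCons a p) z = of_real a + z * cpoly p z"
  by (simp add: map_poly_pCons)

lemma cpoly_add: "cpoly (p + q) z = cpoly p z + cpoly q z"
proof (induction p q rule: poly_induct2)
  case (pCons a p b q)
  then show ?case by (simp add: cpoly_pCons algebra_simps)
qed simp

lemma cpoly_smult: "cpoly (smult c p) z = of_real c * cpoly p z"
  by (induction p) (simp_all add: cpoly_pCons algebra_simps)

lemma cpoly_mult: "cpoly (p * q) z = cpoly p z * cpoly q z"
  by (induction p) (simp_all add: cpoly_pCons cpoly_add cpoly_smult algebra_simps)

lemma cpoly_power: "cpoly (p ^ n) z = cpoly p z ^ n"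
  by (induction n) (simp_all add: cpoly_mult)

lemma cpoly_sum: "cpoly (sum f A) z = (\<Sum>k\<in>A. cpoly (f k) z)"
  by (induction A rule: infinite_finite_induct) (simp_all add: cpoly_add)

lemma cpoly_monom: "cpoly (monom c n) z = of_real c * z ^ n"
  by (simp add: map_poly_monom poly_monom)

lemma cpoly_of_real: "cpoly p (of_real x) = of_real (poly p x)"
  by (induction p) (simp_all add: cpoly_pCons)

lemma cpoly_altdef:
  assumes "degree p \<le> n"
  shows "cpoly p z = (\<Sum>i\<le>n. of_real (coeff p i) * z ^ i)"
proof -
  have "p = (\<Sum>i\<le>n. monom (coeff p i) i)"
    using assms by (simp add: poly_as_sum_of_monoms')
  then have "cpoly p z = cpoly (\<Sum>i\<le>n. monom (coeff p i) i) z" by simp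
  then show ?thesis by (simp add: cpoly_sum cpoly_monom)
qed

lemma only_real_zeros_iff:
  "only_real_zeros p \<longleftrightarrow> p = 0 \<or> (\<forall>z. Im z \<noteq> 0 \<longrightarrow> cpoly p z \<noteq> 0)"
  unfolding only_real_zeros_def by (metis complex_is_Real_iff)

lemma only_real_zeros_linear_power: "only_real_zeros ([:s, 1:] ^ n)"
proof -
  have "of_real s + z \<noteq> 0" if "Im z \<noteq> 0" for z :: complex
    using that by (metis Im_complex_of_real add_cancel_right_left plus_complex.sel(2) zero_complex.sel(2))
  then show ?thesis
    by (simp add: only_real_zeros_iff cpoly_power cpoly_pCons)
qed

lemma only_real_zeros_imp_split:
  assumes "only_real_zeros p" "p \<noteq> 0"
  shows "\<exists>rs. length rs = degree p \<and> p = smult (lead_coeff p) (\<Prod>r\<leftarrow>rs. [:- r, 1:])"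
  using assms
proof (induction "degree p" arbitrary: p)
  case 0
  then show ?case by (auto elim!: degree_eq_zeroE intro: exI[of _ "[]"])
next
  case (Suc n)
  have "degree (map_poly complex_of_real p) = degree p"
    by (rule degree_map_poly) simp
  then obtain z where z: "cpoly p z = 0"
    using fundamental_theorem_of_algebra Suc.hyps(2) by (metis constant_degree nat.distinct(1))
  with Suc.prems have "Im z = 0" by (auto simp: only_real_zeros_iff)
  then obtain r where r: "z = of_real r" by (metis complex_is_Real_iff Reals_cases)
  with z have "poly p r = 0" by (simp add: cpoly_of_real)
  then obtain q where q: "p = [:- r, 1:] * q" by (auto simp: poly_eq_0_iff_dvd dvd_def)
  with Suc.prems have q0: "q \<noteq> 0" by auto
  have deg: "degree p = Suc (degree q)" unfolding q using q0 by (subst degree_mult_eq) auto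
  have lead: "lead_coeff p = lead_coeff q" unfolding q by (subst lead_coeff_mult) simp
  have "only_real_zeros q"
    using Suc.prems unfolding only_real_zeros_iff q cpoly_mult by auto
  then obtain rs where rs: "length rs = degree q"
      "q = smult (lead_coeff q) (\<Prod>r\<leftarrow>rs. [:- r, 1:])"
    using Suc.hyps deg q0 by fastforce
  have "p = smult (lead_coeff p) (\<Prod>r\<leftarrow>r # rs. [:- r, 1:])"
    unfolding lead by (subst q, subst rs(2)) (simp only: list.map prod_list.Cons mult_smult_right)
  then show ?case using rs(1) deg by (intro exI[of _ "r # rs"]) simp
qed

text \<open>
  Every factor \<open>z - r\<close> with \<open>r\<close> real has modulus at least \<open>\<bar>Im z\<bar>\<close>. The bound depends only on the
  leading coefficient and the degree, so it survives limits of polynomials of fixed degree; it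
  takes the place of Hurwitz's theorem.
\<close>
lemma norm_cpoly_ge:
  assumes "only_real_zeros p" "degree p = n"
  shows "norm (cpoly p z) \<ge> \<bar>coeff p n\<bar> * \<bar>Im z\<bar> ^ n"
proof (cases "p = 0")
  case False
  then obtain rs where rs: "length rs = n" "p = smult (coeff p n) (\<Prod>r\<leftarrow>rs. [:- r, 1:])"
    using only_real_zeros_imp_split[OF assms(1)] assms(2) by auto
  have factor: "\<bar>Im z\<bar> \<le> norm (z - of_real r)" for r
    using abs_Im_le_cmod[of "z - of_real r"] by simp
  have "\<bar>Im z\<bar> ^ length rs \<le> norm (cpoly (\<Prod>r\<leftarrow>rs. [:- r, 1:]) z)"
    by (induction rs)
      (use factor in \<open>auto simp: cpoly_pCons cpoly_mult norm_mult intro!: mult_mono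
        simp del: mult_pCons_left\<close>)
  then have "\<bar>coeff p n\<bar> * \<bar>Im z\<bar> ^ n \<le> norm (cpoly (smult (coeff p n) (\<Prod>r\<leftarrow>rs. [:- r, 1:])) z)"
    using rs(1) by (simp add: cpoly_smult norm_mult mult_left_mono)
  then show ?thesis using rs(2) by simp
qed (use assms in auto)

text \<open>
  The Gauss--Lucas argument: in \<open>p'(z) / p(z) = (\<Sum>r. 1 / (z - r))\<close> all summands lie in the open
  half plane opposite to that of \<open>z\<close>, hence so does the sum, which therefore is not zero.
\<close>
lemma only_real_zeros_pderiv:
  assumes "only_real_zeros p"
  shows "only_real_zeros (pderiv p)"
proof (cases "degree p = 0")
  case True
  then show ?thesis by (simp add: only_real_zeros_def pderiv_eq_0_iff)
next
  case False
  then have "p \<noteq> 0" by auto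
  then obtain rs where rs: "length rs = degree p"
      "p = smult (lead_coeff p) (\<Prod>r\<leftarrow>rs. [:- r, 1:])"
    using only_real_zeros_imp_split[OF assms] by auto
  have "cpoly (pderiv p) z \<noteq> 0" if z: "Im z \<noteq> 0" for z
  proof -
    define P where "P rs = (\<Prod>r\<leftarrow>rs. [:- r, 1 :: real:])" for rs
    have P_Cons: "cpoly (P (r # rs)) z = (z - of_real r) * cpoly (P rs) z"
      "cpoly (pderiv (P (r # rs))) z = (z - of_real r) * cpoly (pderiv (P rs)) z + cpoly (P rs) z" for r rs
      by (simp_all add: P_def cpoly_mult cpoly_add pderiv_mult pderiv_pCons cpoly_pCons algebra_simps
          del: mult_pCons_left)
    have nz: "z - of_real r \<noteq> 0" for r using z by auto
    have P_nz: "cpoly (P rs) z \<noteq> 0" for rs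
    proof (induction rs)
      case Nil show ?case by (simp add: P_def)
    next
      case (Cons r rs) then show ?case using nz by (simp add: P_Cons)
    qed
    have neg: "Im (1 / (z - of_real r)) * Im z < 0" for r
    proof -
      have "Im (1 / (z - of_real r)) * Im z = - ((Im z)\<^sup>2 / (norm (z - of_real r))\<^sup>2)"
        by (simp add: Im_divide cmod_power2) (simp add: power2_eq_square)
      then show ?thesis using z nz[of r] by simp
    qed
    have "rs = [] \<or> Im (cpoly (pderiv (P rs)) z / cpoly (P rs) z) * Im z < 0" for rs
    proof (induction rs)
      case (Cons r rs)
      have "cpoly (pderiv (P (r # rs))) z / cpoly (P (r # rs)) z
          = 1 / (z - of_real r) + cpoly (pderiv (P rs)) z / cpoly (P rs) z"
        using nz[of r] P_nz[of rs] by (simp add: P_Cons field_simps)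
      then have "Im (cpoly (pderiv (P (r # rs))) z / cpoly (P (r # rs)) z) * Im z
          = Im (1 / (z - of_real r)) * Im z + Im (cpoly (pderiv (P rs)) z / cpoly (P rs) z) * Im z"
        by (simp add: distrib_right)
      moreover have "Im (cpoly (pderiv (P rs)) z / cpoly (P rs) z) * Im z \<le> 0"
        using Cons by (auto simp: P_def)
      ultimately show ?case using neg[of r] by linarith
    qed simp
    moreover have "rs \<noteq> []" using rs(1) False by auto
    ultimately have "cpoly (pderiv (P rs)) z \<noteq> 0" by fastforce
    moreover have "pderiv p = smult (lead_coeff p) (pderiv (P rs))"
      by (subst rs(2)) (simp add: pderiv_smult P_def)
    ultimately show ?thesis using \<open>p \<noteq> 0\<close> by (simp add: cpoly_smult)
  qed
  then show ?thesis by (auto simp: only_real_zeros_iff)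
qed

lemma quadratic_real_zeros_discriminant:
  fixes b0 b1 b2 :: real
  assumes "only_real_zeros [:b0, 2 * b1, b2:]"
  shows "b0 * b2 \<le> b1\<^sup>2"
proof (cases "b2 = 0")
  case False
  then have "degree [:b0, 2 * b1, b2:] = 2" by simp
  then obtain r s where "[:b0, 2 * b1, b2:] = smult b2 (\<Prod>r\<leftarrow>[r, s]. [:- r, 1:])"
    using only_real_zeros_imp_split[OF assms] False
    by (auto simp: length_Suc_conv numeral_2_eq_2)
  then have "b0 = b2 * (r * s)" "2 * b1 = - b2 * (r + s)"
    by (auto simp: algebra_simps)
  then have "4 * (b1\<^sup>2 - b0 * b2) = (b2 * (r - s))\<^sup>2"
    by algebra
  then have "0 \<le> 4 * (b1\<^sup>2 - b0 * b2)" by (metis zero_le_power2)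
  then show ?thesis by (simp add: zero_le_mult_iff)
qed simp

text \<open>
  The left side is the discriminant divided by \<open>- 27\<close>. For \<open>b3 = 0\<close> the polynomial is at most
  quadratic, and the left side becomes \<open>- b2\<^sup>2 / 3\<close> times the discriminant of that quadratic.
\<close>
lemma cubic_real_zeros_discriminant:
  fixes b0 b1 b2 b3 :: real
  assumes "only_real_zeros [:b0, 3 * b1, 3 * b2, b3:]"
  shows "b0\<^sup>2 * b3\<^sup>2 - 6 * b0 * b1 * b2 * b3 + 4 * b0 * b2 ^ 3 + 4 * b1 ^ 3 * b3 - 3 * b1\<^sup>2 * b2\<^sup>2 \<le> 0"
    (is "?D \<le> 0")
proof (cases "b3 = 0")
  case True
  with assms have "only_real_zeros [:b0, 2 * (3 / 2 * b1), 3 * b2:]" by simp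
  then have "b0 * (3 * b2) \<le> (3 / 2 * b1)\<^sup>2" by (rule quadratic_real_zeros_discriminant)
  then have "4 * (b0 * b2) - 3 * b1\<^sup>2 \<le> 0" by (simp add: power2_eq_square)
  then have "b2\<^sup>2 * (4 * (b0 * b2) - 3 * b1\<^sup>2) \<le> 0" by (simp add: mult_nonneg_nonpos)
  moreover have "?D = b2\<^sup>2 * (4 * (b0 * b2) - 3 * b1\<^sup>2)" using True by algebra
  ultimately show ?thesis by simp
next
  case False
  then have "degree [:b0, 3 * b1, 3 * b2, b3:] = 3" by simp
  then obtain r s t where "[:b0, 3 * b1, 3 * b2, b3:] = smult b3 (\<Prod>r\<leftarrow>[r, s, t]. [:- r, 1:])"
    using only_real_zeros_imp_split[OF assms] False
    by (auto simp: length_Suc_conv numeral_3_eq_3)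
  then have "b0 = - b3 * (r * s * t)" "3 * b1 = b3 * (r * s + s * t + r * t)" "3 * b2 = - b3 * (r + s + t)"
    by (auto simp: algebra_simps)
  then have "27 * ?D = - (b3\<^sup>2 * (r - s) * (s - t) * (r - t))\<^sup>2"
    by algebra
  then have "27 * ?D \<le> 0" by (metis neg_le_0_iff_le zero_le_power2)
  then show ?thesis by (simp add: mult_le_0_iff)
qed

section \<open>Jensen polynomials\<close>

text \<open>
  Umbrally this is \<open>(w + z a) ^ n\<close>, where \<open>a ^ k\<close> stands for \<open>a k\<close>. The homogeneous version makes the
  linear substitutions visible that relate a sequence to its differences.
\<close>
definition binomial_form :: "(nat \<Rightarrow> real) \<Rightarrow> nat \<Rightarrow> 'a::real_field \<Rightarrow> 'a \<Rightarrow> 'a" where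
  "binomial_form a n z w = (\<Sum>k\<le>n. of_nat (n choose k) * of_real (a k) * z ^ k * w ^ (n - k))"

definition jensen_poly :: "(nat \<Rightarrow> real) \<Rightarrow> nat \<Rightarrow> real poly" where
  "jensen_poly a n = (\<Sum>k\<le>n. monom (real (n choose k) * a k) k)"

text \<open>
  For positive \<open>a\<close> this says that \<open>a\<close> is a multiplier sequence (Polya and Schur). Without a sign
  condition it is the weaker property that also differences of multiplier sequences enjoy.
\<close>
definition jensen_hyperbolic :: "(nat \<Rightarrow> real) \<Rightarrow> bool" where
  "jensen_hyperbolic a \<longleftrightarrow> (\<forall>n. only_real_zeros (jensen_poly a n))"

lemma coeff_jensen_poly: "coeff (jensen_poly a n) k = real (n choose k) * a k"
  by (cases "k \<le> n") (simp_all add: jensen_poly_def coeff_sum sum.delta binomial_eq_0)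

lemma cpoly_jensen_poly: "cpoly (jensen_poly a n) z = binomial_form a n z 1"
  by (simp add: jensen_poly_def binomial_form_def cpoly_sum cpoly_monom)

section \<open>The eigenvalues form a multiplier sequence\<close>

lemma tendsto_power_ratio:
  assumes "i \<le> k"
  shows "(\<lambda>m. of_nat m ^ i / of_nat m ^ k :: complex) \<longlonglongrightarrow> (if i = k then 1 else 0)"
proof -
  have "(\<lambda>m. inverse (of_nat m :: complex) ^ (k - i)) \<longlonglongrightarrow> (if i = k then 1 else 0)"
    using assms by (auto intro!: tendsto_null_power lim_inverse_n)
  moreover have "\<forall>\<^sub>F m in sequentially.
      inverse (of_nat m) ^ (k - i) = (of_nat m ^ i / of_nat m ^ k :: complex)"
    using eventually_gt_at_top[of 0]
  proof eventually_elim
    case (elim m)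
    have "(of_nat m :: complex) ^ k = of_nat m ^ i * of_nat m ^ (k - i)"
      using assms by (simp flip: power_add)
    then show ?case using elim by (simp add: field_simps)
  qed
  ultimately show ?thesis by (rule Lim_transform_eventually)
qed

lemma tendsto_cpoly_rescaled:
  assumes "degree U \<le> k"
  shows "(\<lambda>m. cpoly U (of_nat m * z) / of_nat m ^ k) \<longlonglongrightarrow> of_real (coeff U k) * z ^ k"
proof -
  have "(\<lambda>m. \<Sum>i\<le>k. of_real (coeff U i) * z ^ i * (of_nat m ^ i / of_nat m ^ k))
      \<longlonglongrightarrow> (\<Sum>i\<le>k. of_real (coeff U i) * z ^ i * (if i = k then 1 else 0))"
    by (intro tendsto_sum tendsto_mult tendsto_const tendsto_power_ratio) simp
  moreover have "(\<Sum>i\<le>k. of_real (coeff U i) * z ^ i * (of_nat m ^ i / of_nat m ^ k))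
      = cpoly U (of_nat m * z) / of_nat m ^ k" for m
    by (simp add: cpoly_altdef[OF assms] sum_divide_distrib power_mult_distrib mult_ac)
  ultimately show ?thesis by (simp add: if_distrib sum.delta' cong: if_cong)
qed

lemma linear_power_expansion:
  "[:s, 1:] ^ n = (\<Sum>k\<le>n. smult (real (n choose k) * s ^ (n - k)) (monom 1 k))"
proof -
  have "[:s, 1:] = monom 1 1 + [:s:]" by (simp add: monom_altdef)
  then have "[:s, 1:] ^ n = (\<Sum>k\<le>n. of_nat (n choose k) * monom 1 1 ^ k * [:s:] ^ (n - k))"
    by (simp only: binomial_ring)
  also have "\<dots> = (\<Sum>k\<le>n. smult (real (n choose k) * s ^ (n - k)) (monom 1 k))"
    by (intro sum.cong refl) (simp add: monom_power poly_const_pow of_nat_poly smult_monom mult_ac)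
  finally show ?thesis .
qed

text \<open>
  Conjugating \<open>T\<close> by the dilation \<open>x \<longmapsto> m x\<close> and letting \<open>m\<close> tend to infinity kills all entries of \<open>T\<close>
  off the diagonal. What remains is \<open>x ^ n \<longmapsto> a n x ^ n\<close>, which sends \<open>(x + 1) ^ n\<close> to the Jensen
  polynomial. The degrees stay equal to \<open>n\<close> along the way, as \<open>a n \<noteq> 0\<close>, so \<open>norm_cpoly_ge\<close> passes
  to the limit.
\<close>
lemma triangular_hyperbolic_imp_jensen:
  assumes "Vector_Spaces.linear smult smult T"
    and hyp: "hyperbolicity_preserving T"
    and deg: "\<And>p n. degree p \<le> n \<Longrightarrow> degree (T p) \<le> n"
    and diag: "\<And>p n. degree p \<le> n \<Longrightarrow> coeff (T p) n = a n * coeff p n"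
    and nz: "\<And>n. a n \<noteq> 0"
  shows "only_real_zeros (jensen_poly a n)"
proof -
  interpret Vector_Spaces.linear smult smult T by fact
  define p where "p m = T ([:real m, 1:] ^ n)" for m
  have real: "only_real_zeros (p m)" for m
    using hyp only_real_zeros_linear_power by (simp add: p_def hyperbolicity_preserving_def)
  have lead: "coeff (p m) n = a n" for m
    by (simp add: p_def diag degree_linear_power coeff_linear_power)
  have degp: "degree (p m) = n" for m
    using deg[of "[:real m, 1:] ^ n" n] le_degree[of "p m" n] lead[of m] nz[of n]
    by (simp add: p_def degree_linear_power)
  have "cpoly (jensen_poly a n) z \<noteq> 0" if z: "Im z \<noteq> 0" for z
  proof -
    have "(\<lambda>m. \<Sum>k\<le>n. of_nat (n choose k) * (cpoly (T (monom 1 k)) (of_nat m * z) / of_nat m ^ k))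
        \<longlonglongrightarrow> (\<Sum>k\<le>n. of_nat (n choose k) * (of_real (coeff (T (monom 1 k)) k) * z ^ k))"
      by (intro tendsto_sum tendsto_mult tendsto_const tendsto_cpoly_rescaled deg) (simp add: degree_monom_le)
    also have "(\<Sum>k\<le>n. of_nat (n choose k) * (of_real (coeff (T (monom 1 k)) k) * z ^ k))
        = cpoly (jensen_poly a n) z"
      by (simp add: cpoly_jensen_poly binomial_form_def diag degree_monom_le mult.assoc)
    finally have lim: "(\<lambda>m. \<Sum>k\<le>n. of_nat (n choose k) *
        (cpoly (T (monom 1 k)) (of_nat m * z) / of_nat m ^ k)) \<longlonglongrightarrow> cpoly (jensen_poly a n) z" .
    have "\<bar>a n\<bar> * \<bar>Im z\<bar> ^ n \<le> norm (\<Sum>k\<le>n. of_nat (n choose k) *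
        (cpoly (T (monom 1 k)) (of_nat m * z) / of_nat m ^ k))" if m: "m > 0" for m
    proof -
      have ratio: "(of_nat m :: complex) ^ (n - k) / of_nat m ^ n = 1 / of_nat m ^ k" if "k \<le> n" for k
        using m that by (simp add: power_diff)
      have "cpoly (p m) (of_nat m * z) / of_nat m ^ n
          = (\<Sum>k\<le>n. of_nat (n choose k) * cpoly (T (monom 1 k)) (of_nat m * z)
              * (of_nat m ^ (n - k) / of_nat m ^ n))"
        by (simp add: p_def linear_power_expansion sum scale cpoly_sum cpoly_smult
            sum_divide_distrib mult_ac)
      also have "\<dots> = (\<Sum>k\<le>n. of_nat (n choose k) *
          (cpoly (T (monom 1 k)) (of_nat m * z) / of_nat m ^ k))"
        by (intro sum.cong refl) (simp add: ratio)
      finally have eq: "cpoly (p m) (of_nat m * z) / of_nat m ^ n = \<dots>" .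
      have "\<bar>a n\<bar> * \<bar>Im (of_nat m * z)\<bar> ^ n \<le> norm (cpoly (p m) (of_nat m * z))"
        using norm_cpoly_ge[OF real degp] lead by metis
      then have "\<bar>a n\<bar> * \<bar>Im z\<bar> ^ n \<le> norm (cpoly (p m) (of_nat m * z) / of_nat m ^ n)"
        using m by (simp add: norm_divide norm_power abs_mult power_mult_distrib field_simps)
      then show ?thesis by (simp only: eq)
    qed
    then have "\<forall>\<^sub>F m in sequentially. \<bar>a n\<bar> * \<bar>Im z\<bar> ^ n \<le> norm (\<Sum>k\<le>n. of_nat (n choose k) *
        (cpoly (T (monom 1 k)) (of_nat m * z) / of_nat m ^ k))"
      by (intro eventually_mono[OF eventually_gt_at_top[of 0]])
    then have "\<bar>a n\<bar> * \<bar>Im z\<bar> ^ n \<le> norm (cpoly (jensen_poly a n) z)"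
      by (rule tendsto_lowerbound[OF tendsto_norm[OF lim]]) simp
    moreover have "0 < \<bar>a n\<bar> * \<bar>Im z\<bar> ^ n" using z nz[of n] by simp
    ultimately show ?thesis by auto
  qed
  then show ?thesis by (simp add: only_real_zeros_iff)
qed

section \<open>Shifts and differences of a sequence\<close>

definition fdiff :: "(nat \<Rightarrow> real) \<Rightarrow> nat \<Rightarrow> real" where
  "fdiff a j = a (Suc j) - a j"

lemma pderiv_jensen_poly:
  "pderiv (jensen_poly a (Suc n)) = smult (real (Suc n)) (jensen_poly (\<lambda>k. a (Suc k)) n)"
proof (rule poly_eqI)
  fix k
  have "real (Suc k) * real (Suc n choose Suc k) = real (Suc n) * real (n choose k)"
    by (simp only: Suc_times_binomial flip: of_nat_mult)
  then show "coeff (pderiv (jensen_poly a (Suc n))) k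
      = coeff (smult (real (Suc n)) (jensen_poly (\<lambda>k. a (Suc k)) n)) k"
    by (simp only: coeff_pderiv coeff_smult coeff_jensen_poly flip: mult.assoc)
qed

lemma jensen_hyperbolic_shift:
  assumes "jensen_hyperbolic a"
  shows "jensen_hyperbolic (\<lambda>k. a (j + k))"
proof (induction j)
  case (Suc j)
  have "only_real_zeros (smult (real (Suc n)) (jensen_poly (\<lambda>k. a (Suc j + k)) n))" for n
    using only_real_zeros_pderiv[of "jensen_poly (\<lambda>k. a (j + k)) (Suc n)"] Suc
    by (simp add: jensen_hyperbolic_def pderiv_jensen_poly del: of_nat_Suc)
  moreover have "only_real_zeros p" if "only_real_zeros (smult (real (Suc n)) p)" for p n
    using that by (auto simp: only_real_zeros_iff cpoly_smult)
  ultimately show ?case by (auto simp: jensen_hyperbolic_def)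
qed (use assms in simp)

lemma binomial_form_Suc:
  "binomial_form a (Suc n) z w = w * binomial_form a n z w + z * binomial_form (\<lambda>k. a (Suc k)) n z w"
proof -
  have "binomial_form a (Suc n) z w = of_real (a 0) * w ^ Suc n
      + (\<Sum>k\<le>n. of_nat (n choose Suc k) * of_real (a (Suc k)) * z ^ Suc k * w ^ (n - k))
      + z * binomial_form (\<lambda>k. a (Suc k)) n z w"
    unfolding binomial_form_def
    by (subst sum.atMost_Suc_shift) (simp add: algebra_simps sum.distrib sum_distrib_left)
  also have "(\<Sum>k\<le>n. of_nat (n choose Suc k) * of_real (a (Suc k)) * z ^ Suc k * w ^ (n - k))
      = (\<Sum>k<n. of_nat (n choose Suc k) * of_real (a (Suc k)) * z ^ Suc k * w ^ (n - k))"
    by (rule sum.mono_neutral_right) auto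
  also have "\<dots> = (\<Sum>k<n. w * (of_nat (n choose Suc k) * of_real (a (Suc k)) * z ^ Suc k * w ^ (n - Suc k)))"
    by (intro sum.cong refl) (simp add: Suc_diff_Suc power_Suc[symmetric] mult_ac del: power_Suc)
  also have "of_real (a 0) * w ^ Suc n + \<dots> = w * binomial_form a n z w"
    unfolding binomial_form_def
    by (subst sum.atMost_shift) (simp add: algebra_simps sum_distrib_left)
  finally show ?thesis .
qed

text \<open>
  Umbrally \<open>(1 + z (a - 1)) ^ n = ((1 - z) + z a) ^ n\<close>, since taking differences is multiplication
  by \<open>a - 1\<close>. The case \<open>z = 1\<close> is Newton's forward difference formula.
\<close>
lemma binomial_form_differences:
  "binomial_form (\<lambda>k. (fdiff ^^ k) a 0) n z 1 = binomial_form a n z (1 - z)"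
proof (induction n arbitrary: a)
  case 0
  show ?case by (simp add: binomial_form_def)
next
  case (Suc n)
  have "binomial_form (\<lambda>k. (fdiff ^^ k) a 0) (Suc n) z 1
      = binomial_form a n z (1 - z) + z * binomial_form (fdiff a) n z (1 - z)"
    using Suc.IH[of a] Suc.IH[of "fdiff a"]
    by (simp add: binomial_form_Suc funpow_Suc_right del: funpow.simps)
  moreover have "binomial_form (fdiff a) n z (1 - z)
      = binomial_form (\<lambda>k. a (Suc k)) n z (1 - z) - binomial_form a n z (1 - z)"
    by (simp add: binomial_form_def fdiff_def algebra_simps sum_subtractf)
  ultimately show ?case by (simp add: binomial_form_Suc algebra_simps)
qed

lemma newton_forward: "a n = (\<Sum>k\<le>n. real (n choose k) * (fdiff ^^ k) a 0)"
proof -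
  have "binomial_form a n (1 :: real) 0 = (\<Sum>k\<le>n. if k = n then a n else 0)"
    unfolding binomial_form_def by (intro sum.cong refl) (auto simp: power_0_left)
  then show ?thesis
    using binomial_form_differences[of a n "1 :: real"] by (simp add: binomial_form_def)
qed

text \<open>
  By \<open>binomial_form_differences\<close> the Jensen polynomial of the differences at \<open>z\<close> is
  \<open>(1 - z) ^ n\<close> times the Jensen polynomial of \<open>a\<close> at \<open>z / (1 - z)\<close>, and this real Moebius map
  sends nonreal points to nonreal points.
\<close>
lemma jensen_hyperbolic_differences:
  assumes "jensen_hyperbolic a"
  shows "jensen_hyperbolic (\<lambda>k. (fdiff ^^ k) a 0)"
  unfolding jensen_hyperbolic_def
proof
  fix n
  let ?b = "\<lambda>k. (fdiff ^^ k) a 0"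
  have real: "only_real_zeros (jensen_poly a n)" using assms by (simp add: jensen_hyperbolic_def)
  show "only_real_zeros (jensen_poly ?b n)"
  proof (cases "jensen_poly a n = 0")
    case True
    then have "a k = 0" if "k \<le> n" for k
      using coeff_jensen_poly[of a n k] that by simp
    then have "binomial_form a n x (1 - x) = 0" for x :: real
      by (simp add: binomial_form_def)
    moreover have "poly (jensen_poly ?b n) x = binomial_form ?b n x 1" for x
      by (simp add: jensen_poly_def binomial_form_def poly_sum poly_monom)
    ultimately have "poly (jensen_poly ?b n) x = 0" for x
      by (simp add: binomial_form_differences)
    then have "jensen_poly ?b n = 0" by (simp flip: poly_all_0_iff_0)
    then show ?thesis by (simp add: only_real_zeros_def)
  next
    case False
    have "cpoly (jensen_poly ?b n) z \<noteq> 0" if z: "Im z \<noteq> 0" for z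
    proof -
      have z1: "1 - z \<noteq> 0" using z by auto
      have "binomial_form a n z (1 - z) = (1 - z) ^ n * binomial_form a n (z / (1 - z)) 1"
        using z1 by (simp add: binomial_form_def sum_distrib_left power_divide power_diff mult_ac)
      moreover have "Im (z / (1 - z)) \<noteq> 0"
      proof
        assume "Im (z / (1 - z)) = 0"
        then obtain r where r: "z / (1 - z) = of_real r" by (metis complex_is_Real_iff Reals_cases)
        then have "z = of_real r * (1 - z)" using z1 by (simp add: field_simps)
        then have eq: "z * of_real (1 + r) = of_real r" by (simp add: algebra_simps)
        then have "Im (z * of_real (1 + r)) = 0" by (simp only: Im_complex_of_real)
        then have "Im z * (1 + r) = 0" by simp
        with z have "r = -1" by simp
        with eq show False by simp
      qed
      then have "binomial_form a n (z / (1 - z)) 1 \<noteq> 0"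
        using real False by (auto simp: only_real_zeros_iff cpoly_jensen_poly)
      ultimately show ?thesis
        using z1 by (simp add: cpoly_jensen_poly binomial_form_differences)
    qed
    then show ?thesis by (simp add: only_real_zeros_iff)
  qed
qed

lemma fdiff_shift: "(fdiff ^^ k) (\<lambda>i. a (j + i)) 0 = (fdiff ^^ k) a j"
proof (induction k arbitrary: j a)
  case (Suc k)
  have "fdiff (\<lambda>i. a (j + i)) = (\<lambda>i. fdiff a (j + i))" by (simp add: fdiff_def fun_eq_iff)
  with Suc show ?case by (simp add: funpow_Suc_right del: funpow.simps)
qed simp

lemma jensen_hyperbolic_higher_differences:
  assumes "jensen_hyperbolic a"
  shows "jensen_hyperbolic (\<lambda>i. (fdiff ^^ i) ((fdiff ^^ k) a) j)"
proof -
  have "jensen_hyperbolic (\<lambda>i. (fdiff ^^ i) (\<lambda>i. a (j + i)) 0)"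
    by (intro jensen_hyperbolic_differences jensen_hyperbolic_shift assms)
  then have "jensen_hyperbolic (\<lambda>i. (fdiff ^^ (k + i)) a j)"
    using jensen_hyperbolic_shift[of "\<lambda>i. (fdiff ^^ i) a j" k] by (simp add: fdiff_shift)
  then show ?thesis by (simp add: funpow_add add.commute[of k])
qed

section \<open>Signs of the higher differences\<close>

lemma jensen_hyperbolic_quadratic:
  assumes "jensen_hyperbolic b"
  shows "b 0 * b 2 \<le> (b 1)\<^sup>2"
proof -
  have "jensen_poly b 2 = [:b 0, 2 * b 1, b 2:]"
    by (simp add: jensen_poly_def numeral_2_eq_2 monom_altdef)
  then show ?thesis
    using assms quadratic_real_zeros_discriminant by (metis jensen_hyperbolic_def)
qed

lemma jensen_hyperbolic_cubic:
  assumes "jensen_hyperbolic b"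
  shows "(b 0)\<^sup>2 * (b 3)\<^sup>2 - 6 * b 0 * b 1 * b 2 * b 3 + 4 * b 0 * b 2 ^ 3
    + 4 * b 1 ^ 3 * b 3 - 3 * (b 1)\<^sup>2 * (b 2)\<^sup>2 \<le> 0"
proof -
  have "jensen_poly b 3 = [:b 0, 3 * b 1, 3 * b 2, b 3:]"
    by (simp add: jensen_poly_def numeral_3_eq_3 numeral_2_eq_2 monom_altdef)
  then show ?thesis
    using assms cubic_real_zeros_discriminant by (metis jensen_hyperbolic_def)
qed

text \<open>
  The quadratic inequality compares the differences of orders \<open>k\<close>, \<open>k + 1\<close> and \<open>k + 2\<close> at one place.
  It has the same discriminant as its counterpart for three consecutive terms of the sequence of
  \<open>k\<close>-th differences.
\<close>
lemma jensen_hyperbolic_log_concave: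
  assumes "jensen_hyperbolic a"
  shows "(fdiff ^^ k) a j * (fdiff ^^ k) a (j + 2) \<le> ((fdiff ^^ k) a (j + 1))\<^sup>2"
proof -
  define f where "f = (fdiff ^^ k) a"
  have D: "fdiff f j = f (j + 1) - f j" "(fdiff ^^ 2) f j = f (j + 2) - 2 * f (j + 1) + f j"
    by (simp_all add: fdiff_def numeral_2_eq_2)
  have "f j * (fdiff ^^ 2) f j \<le> (fdiff f j)\<^sup>2"
    using jensen_hyperbolic_quadratic[OF jensen_hyperbolic_higher_differences[OF assms, of k j]]
    by (simp add: f_def)
  then have "f j * f (j + 2) \<le> (f (j + 1))\<^sup>2"
    unfolding D by (simp add: power2_eq_square algebra_simps)
  then show ?thesis by (simp only: f_def)
qed

text \<open>
  Log-concavity alone does not force the differences \<open>c\<close> of \<open>f\<close> to be nondecreasing: \<open>1 - r ^ j / 2\<close>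
  with \<open>0 < r < 1\<close> is log-concave with log-concave differences. The cubic inequality excludes this.
  If \<open>c\<close> decreases once, log-concavity makes it decay geometrically, so \<open>f\<close> converges to some
  \<open>L > 0\<close>. The Jensen polynomial of \<open>f (j + _)\<close> of degree 3 is then \<open>L (1 + x) ^ 3\<close> plus a
  perturbation of order \<open>c j\<close> that does not vanish at \<open>- 1\<close>; a perturbed triple zero splits like
  three cube roots, of which only one is real. In terms of the cubic inequality: its left side,
  divided by \<open>(c j)\<^sup>2\<close>, tends to \<open>L\<^sup>2 (1 - s) ^ 4 > 0\<close>, where \<open>s < 1\<close> is the limit of the
  ratios \<open>c (Suc j) / c j\<close>.
\<close>
lemma fdiff_pos_mono_or_zero:
  assumes pos: "\<And>j. 0 < f j" and mono: "\<And>j. 0 \<le> fdiff f j"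
    and lc: "\<And>j. f j * f (j + 2) \<le> (f (j + 1))\<^sup>2"
    and lc': "\<And>j. fdiff f j * fdiff f (j + 2) \<le> (fdiff f (j + 1))\<^sup>2"
    and cubic: "\<And>j. (f j)\<^sup>2 * ((fdiff ^^ 3) f j)\<^sup>2
        - 6 * f j * fdiff f j * (fdiff ^^ 2) f j * (fdiff ^^ 3) f j + 4 * f j * (fdiff ^^ 2) f j ^ 3
        + 4 * fdiff f j ^ 3 * (fdiff ^^ 3) f j - 3 * (fdiff f j)\<^sup>2 * ((fdiff ^^ 2) f j)\<^sup>2 \<le> 0"
  shows "(\<forall>j. fdiff f j = 0) \<or> (\<forall>j. 0 < fdiff f j \<and> fdiff f j \<le> fdiff f (Suc j))"
proof (cases "\<exists>j. fdiff f j = 0")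
  case True
  define c where "c = fdiff f"
  \<comment> \<open>A zero of \<open>c\<close> spreads forwards by log-concavity and backwards by the cubic inequality.\<close>
  have forward: "c (Suc j) = 0" if "c j = 0" for j
  proof -
    have "f (Suc j) = f j" using that by (simp add: c_def fdiff_def)
    then have "f j * f (Suc (Suc j)) \<le> f j * f j" using lc[of j] by (simp add: power2_eq_square)
    then have "f (Suc (Suc j)) \<le> f (Suc j)" using pos[of j] \<open>f (Suc j) = f j\<close> by simp
    then show ?thesis using mono[of "Suc j"] by (simp add: c_def fdiff_def)
  qed
  have backward: "c j = 0" if "c (Suc j) = 0" for j
  proof -
    have 2: "c (Suc (Suc j)) = 0" using that by (rule forward)
    have D: "(fdiff ^^ 2) f j = - c j" "(fdiff ^^ 3) f j = c j"
      using that 2 by (simp_all add: c_def fdiff_def numeral_2_eq_2 numeral_3_eq_3)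
    have "(c j * (f j + c j))\<^sup>2 \<le> 0"
      using cubic[of j] unfolding D c_def[symmetric]
      by (simp add: power2_eq_square power3_eq_cube algebra_simps)
    moreover have "f j + c j > 0" using pos[of j] mono[of j] by (simp add: c_def)
    ultimately show ?thesis by simp
  qed
  from True obtain i where i: "c i = 0" by (auto simp: c_def)
  have c0: "c j = 0 \<Longrightarrow> c 0 = 0" for j by (induction j) (auto intro: backward)
  have "c 0 = 0" using i by (rule c0)
  then have "c j = 0" for j by (induction j) (auto intro: forward)
  then show ?thesis by (simp add: c_def)
next
  case False
  define c where "c = fdiff f"
  have c_pos: "0 < c j" for j using False mono[of j] by (auto simp: c_def less_le)
  define t where "t j = c (Suc j) / c j" for j
  have t_pos: "0 < t j" for j using c_pos by (simp add: t_def)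
  have c_Suc: "c (Suc j) = t j * c j" for j using c_pos[of j] by (simp add: t_def)
  have "t (Suc j) \<le> t j" for j
    using lc'[of j] c_pos[of j] c_pos[of "Suc j"]
    by (simp add: t_def c_def field_simps power2_eq_square)
  then have t_dec: "decseq t" by (simp add: decseq_Suc_iff)
  have "c i \<le> c (Suc i)" for i
  proof (rule ccontr)
    assume "\<not> c i \<le> c (Suc i)"
    then have ti: "t i < 1" using c_pos[of i] by (simp add: t_def)
    obtain s where s: "t \<longlonglongrightarrow> s"
      using decseq_convergent[OF t_dec, of 0] t_pos by (meson less_imp_le)
    have "s \<le> t i" using t_dec s by (rule decseq_ge)
    with ti have s1: "s < 1" by simp
    have geo: "c (i + d) \<le> c i * t i ^ d" for d
    proof (induction d)
      case (Suc d)
      have "t (i + d) \<le> t i" using t_dec by (simp add: decseq_def)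
      then have "c (i + Suc d) \<le> t i * c (i + d)"
        using c_pos[of "i + d"] by (simp add: c_Suc mult_right_mono)
      also have "\<dots> \<le> t i * (c i * t i ^ d)"
        using Suc t_pos[of i] by (simp add: mult_left_mono)
      finally show ?case by (simp add: mult_ac)
    qed simp
    have geo_lim: "summable (\<lambda>d. c i * t i ^ d)"
      using ti t_pos[of i] by (intro summable_mult summable_geometric) simp
    have "summable (\<lambda>d. c (i + d))"
      by (rule summable_comparison_test'[OF geo_lim, of 0])
        (use geo c_pos in \<open>auto simp: less_imp_le\<close>)
    then have c_sum: "summable c" by (simp add: add.commute[of i] summable_iff_shift)
    then have c_lim: "c \<longlonglongrightarrow> 0" by (rule summable_LIMSEQ_zero)
    have "f 0 + (\<Sum>j<n. c j) = f n" for n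
      by (induction n) (simp_all add: c_def fdiff_def)
    moreover have "(\<lambda>n. f 0 + (\<Sum>j<n. c j)) \<longlonglongrightarrow> f 0 + suminf c"
      by (intro tendsto_add tendsto_const summable_LIMSEQ c_sum)
    ultimately obtain L where L: "f \<longlonglongrightarrow> L" by simp
    have "f 0 \<le> f n" for n
      using mono by (induction n) (auto simp: fdiff_def intro: order_trans)
    then have "f 0 \<le> L" using L by (intro LIMSEQ_le_const) auto
    then have L_pos: "0 < L" using pos[of 0] by simp
    define w where "w j = 1 - 2 * t j + t j * t (Suc j)" for j
    have fdiff_c: "fdiff f = c" "fdiff c j = - ((1 - t j) * c j)" for j
      by (simp_all add: c_def[symmetric] fdiff_def[of c] c_Suc algebra_simps)
    have D: "fdiff f j = c j" "(fdiff ^^ 2) f j = - ((1 - t j) * c j)" "(fdiff ^^ 3) f j = w j * c j" for j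
      by (simp_all add: numeral_2_eq_2 numeral_3_eq_3 fdiff_c fdiff_def[of "fdiff c"] w_def c_Suc)
        (simp add: algebra_simps)
    have "(f j)\<^sup>2 * (w j)\<^sup>2 + 6 * f j * (1 - t j) * w j * c j - 4 * f j * (1 - t j) ^ 3 * c j
        + 4 * (c j)\<^sup>2 * w j - 3 * (1 - t j)\<^sup>2 * (c j)\<^sup>2 \<le> 0" (is "?E j \<le> 0") for j
    proof -
      have "(c j)\<^sup>2 * ?E j \<le> 0"
        using cubic[of j] unfolding D by (simp add: power2_eq_square power3_eq_cube algebra_simps)
      then show ?thesis using c_pos[of j] by (simp add: mult_le_0_iff)
    qed
    moreover have "?E \<longlonglongrightarrow> L\<^sup>2 * (1 - 2 * s + s * s)\<^sup>2 + 6 * L * (1 - s) * (1 - 2 * s + s * s) * 0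
        - 4 * L * (1 - s) ^ 3 * 0 + 4 * 0\<^sup>2 * (1 - 2 * s + s * s) - 3 * (1 - s)\<^sup>2 * 0\<^sup>2"
      unfolding w_def by (intro tendsto_intros L s c_lim LIMSEQ_Suc)
    ultimately have "L\<^sup>2 * (1 - 2 * s + s * s)\<^sup>2 \<le> 0"
      using LIMSEQ_le_const2 by fastforce
    moreover have "1 - 2 * s + s * s = (1 - s)\<^sup>2" by (simp add: power2_eq_square algebra_simps)
    ultimately show False using L_pos s1 by (simp add: mult_le_0_iff)
  qed
  then show ?thesis using c_pos by (simp add: c_def)
qed

lemma higher_differences_pos_or_zero:
  assumes "jensen_hyperbolic a" and "\<And>n. 0 < a n \<and> a n \<le> a (Suc n)"
  shows "(\<forall>j. (fdiff ^^ k) a j = 0) \<or>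
    (\<forall>j. 0 < (fdiff ^^ k) a j \<and> (fdiff ^^ k) a j \<le> (fdiff ^^ k) a (Suc j))"
proof (induction k)
  case 0
  show ?case using assms(2) by simp
next
  case (Suc k)
  define f where "f = (fdiff ^^ k) a"
  have Suc_f: "(fdiff ^^ Suc k) a = fdiff f" by (simp add: f_def)
  from Suc.IH show ?case unfolding Suc_f f_def[symmetric]
  proof
    assume "\<forall>j. f j = 0"
    then show "(\<forall>j. fdiff f j = 0) \<or> (\<forall>j. 0 < fdiff f j \<and> fdiff f j \<le> fdiff f (Suc j))"
      by (simp add: fdiff_def)
  next
    assume f: "\<forall>j. 0 < f j \<and> f j \<le> f (Suc j)"
    show "(\<forall>j. fdiff f j = 0) \<or> (\<forall>j. 0 < fdiff f j \<and> fdiff f j \<le> fdiff f (Suc j))"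
    proof (rule fdiff_pos_mono_or_zero)
      show "0 < f j" "0 \<le> fdiff f j" for j using f by (auto simp: fdiff_def)
      show "f j * f (j + 2) \<le> (f (j + 1))\<^sup>2" for j
        using jensen_hyperbolic_log_concave[OF assms(1), of k] by (simp add: f_def)
      show "fdiff f j * fdiff f (j + 2) \<le> (fdiff f (j + 1))\<^sup>2" for j
        using jensen_hyperbolic_log_concave[OF assms(1), of "Suc k"] by (simp add: Suc_f del: funpow.simps)
    next
      fix j
      show "(f j)\<^sup>2 * ((fdiff ^^ 3) f j)\<^sup>2
        - 6 * f j * fdiff f j * (fdiff ^^ 2) f j * (fdiff ^^ 3) f j + 4 * f j * (fdiff ^^ 2) f j ^ 3
        + 4 * fdiff f j ^ 3 * (fdiff ^^ 3) f j - 3 * (fdiff f j)\<^sup>2 * ((fdiff ^^ 2) f j)\<^sup>2 \<le> 0"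
        using jensen_hyperbolic_cubic[OF jensen_hyperbolic_higher_differences[OF assms(1), of k j]]
        unfolding f_def[symmetric] by simp
    qed
  qed
qed

section \<open>Newton interpolation\<close>

lemma higher_differences_zero_imp_interpolated:
  assumes "\<And>j. (fdiff ^^ k) a j = 0" "0 < k"
  shows "\<exists>p. interpolated_by a p \<and> degree p < k"
proof -
  define P where "P i = (\<Prod>j<i. [:- real j, 1:])" for i
  define p where "p = (\<Sum>i<k. smult ((fdiff ^^ i) a 0 / fact i) (P i))"
  have P: "poly (P i) (real n) / fact i = real (n choose i)" for i n
    by (simp add: P_def poly_prod binomial_gbinomial gbinomial_prod_rev atLeast0LessThan)
  have degP: "degree (P i) \<le> i" for i
    unfolding P_def using degree_prod_sum_le[of "{..<i}" "\<lambda>j. [:- real j, 1:]"] by (simp add: o_def)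
  have "degree (smult ((fdiff ^^ i) a 0 / fact i) (P i)) \<le> k - 1" if "i < k" for i
    using order_trans[OF degree_smult_le degP, of "(fdiff ^^ i) a 0 / fact i" i] that by simp
  then have "degree p \<le> k - 1" unfolding p_def by (intro degree_sum_le) auto
  moreover have "a n = poly p (real n)" for n
  proof -
    have zero: "(fdiff ^^ i) a 0 = 0" if "k \<le> i" for i
    proof -
      have fk: "(fdiff ^^ k) a = (\<lambda>_. 0)" using assms(1) by (simp add: fun_eq_iff)
      have "(fdiff ^^ d) (\<lambda>_. 0) = (\<lambda>_. 0)" for d
        by (induction d) (simp_all add: fdiff_def fun_eq_iff)
      then have "(fdiff ^^ ((i - k) + k)) a 0 = 0" by (simp only: funpow_add o_apply fk)
      with that show ?thesis by simp
    qed
    have "a n = (\<Sum>i\<le>n. real (n choose i) * (fdiff ^^ i) a 0)" by (rule newton_forward)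
    also have "\<dots> = (\<Sum>i\<in>{..n} \<union> {..<k}. real (n choose i) * (fdiff ^^ i) a 0)"
      by (rule sum.mono_neutral_left) auto
    also have "\<dots> = (\<Sum>i<k. real (n choose i) * (fdiff ^^ i) a 0)"
      by (rule sum.mono_neutral_right) (auto simp: zero)
    also have "\<dots> = poly p (real n)"
      by (simp add: p_def poly_sum mult.commute flip: P)
    finally show ?thesis .
  qed
  ultimately show ?thesis using assms(2) by (intro exI[of _ p]) (auto simp: interpolated_by_def)
qed

lemma interpolated_by_unique:
  assumes "interpolated_by a p" "interpolated_by a q"
  shows "p = q"
proof (rule poly_eqI_degree[of "of_nat ` {..degree p + degree q}"])
  show "poly p x = poly q x" if "x \<in> real ` {..degree p + degree q}" for x
    using assms that by (auto simp: interpolated_by_def)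
qed (simp_all add: card_image inj_on_def)

section \<open>Coefficients of the operator\<close>

lemma eigenbasis_imp_triangular:
  assumes "Vector_Spaces.linear smult smult T"
    and B: "\<And>n. has_degree (B n) n" and eig: "\<And>n. T (B n) = smult (a n) (B n)"
    and "degree p \<le> n"
  shows "degree (T p) \<le> n \<and> coeff (T p) n = a n * coeff p n"
  using \<open>degree p \<le> n\<close>
proof (induction n arbitrary: p rule: less_induct)
  case (less n)
  interpret Vector_Spaces.linear smult smult T by fact
  define c where "c = coeff p n / coeff (B n) n"
  define r where "r = p - smult c (B n)"
  have Bn: "coeff (B n) n \<noteq> 0" "degree (B n) = n"
    using B[of n] by (metis has_degree_def leading_coeff_0_iff)+
  have p: "p = smult c (B n) + r" by (simp add: r_def)
  have "degree r \<le> n" unfolding r_def using less.prems Bn by (intro degree_diff_le) auto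
  moreover have rn: "coeff r n = 0" using Bn by (simp add: r_def c_def)
  ultimately have r: "r = 0 \<or> degree r < n"
    by (metis le_neq_implies_less leading_coeff_0_iff)
  have "degree (T r) \<le> n \<and> coeff (T r) n = 0"
  proof (cases "r = 0")
    case False
    with r have "degree r < n" by simp
    then have "degree (T r) < n" using less.IH[of "degree r" r] by simp
    then show ?thesis by (simp add: coeff_eq_0)
  qed (simp add: zero)
  moreover have Tp: "T p = smult (c * a n) (B n) + T r"
    by (simp add: p add scale eig)
  ultimately show ?case
    using Bn rn unfolding Tp by (auto simp: p intro!: degree_add_le)
qed

lemma higher_pderiv_monom_binomial:
  "(pderiv ^^ k) (monom 1 n) = (monom (fact k * real (n choose k)) (n - k) :: real poly)"
proof (induction k)
  case (Suc k)
  have "real (n - k) * real (n choose k) = real (Suc k) * real (n choose Suc k)"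
    using binomial_absorb_comp[of n k] binomial_absorption[of k n]
    by (metis of_nat_mult mult.commute binomial_absorption)
  then show ?case by (simp add: Suc pderiv_monom algebra_simps)
qed simp

text \<open>
  Comparing coefficients of \<open>x ^ n\<close> in the image of \<open>x ^ n\<close> gives
  \<open>a n = (\<Sum>k\<le>n. (n choose k) * (k! * [x ^ k] Q k))\<close>. Newton's formula has the same shape, and the
  coefficients in such an expansion are unique.
\<close>
lemma triangular_coeffs:
  assumes deg: "\<And>p n. degree p \<le> n \<Longrightarrow> degree (diff_op Q p) \<le> n"
    and diag: "\<And>p n. degree p \<le> n \<Longrightarrow> coeff (diff_op Q p) n = a n * coeff p n"
  shows "degree (Q k) \<le> k" and "fact k * coeff (Q k) k = (fdiff ^^ k) a 0"
proof -
  have op: "diff_op Q (monom 1 n) = (\<Sum>k\<le>n. Q k * monom (fact k * real (n choose k)) (n - k))" for n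
    by (simp add: diff_op_def higher_pderiv_monom_binomial degree_monom_eq)
  have split: "{..n} = insert n {..<n}" for n :: nat by auto
  have degQ: "degree (Q n) \<le> n" for n
  proof (induction n rule: less_induct)
    case (less n)
    let ?R = "\<Sum>k<n. Q k * monom (fact k * real (n choose k)) (n - k)"
    have "degree (Q k * monom (fact k * real (n choose k)) (n - k)) \<le> n" if "k < n" for k
    proof -
      have "degree (Q k * monom (fact k * real (n choose k)) (n - k))
          \<le> degree (Q k) + degree (monom (fact k * real (n choose k)) (n - k))"
        by (rule degree_mult_le)
      also have "\<dots> \<le> k + (n - k)" using less that by (intro add_mono degree_monom_le) auto
      finally show ?thesis using that by simp
    qed
    then have R: "degree ?R \<le> n" by (intro degree_sum_le) auto
    have "diff_op Q (monom 1 n) = smult (fact n) (Q n) + ?R"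
      by (simp add: op split monom_0)
    then have "smult (fact n) (Q n) = diff_op Q (monom 1 n) - ?R" by simp
    then have "degree (smult (fact n) (Q n)) \<le> n"
      using R deg[of "monom 1 n" n] by (simp add: degree_diff_le degree_monom_le)
    then show ?case by simp
  qed
  then show "degree (Q k) \<le> k" .
  have expand: "a n = (\<Sum>k\<le>n. real (n choose k) * (fact k * coeff (Q k) k))" for n
  proof -
    have "a n = coeff (diff_op Q (monom 1 n)) n"
      using diag[of "monom 1 n" n] by (simp add: degree_monom_le)
    also have "\<dots> = (\<Sum>k\<le>n. coeff (monom (fact k * real (n choose k)) (n - k) * Q k) n)"
      by (simp add: op coeff_sum mult.commute)
    also have "\<dots> = (\<Sum>k\<le>n. real (n choose k) * (fact k * coeff (Q k) k))"
      by (intro sum.cong refl) (simp add: coeff_monom_mult)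
    finally show ?thesis .
  qed
  show "fact k * coeff (Q k) k = (fdiff ^^ k) a 0"
  proof (induction k rule: less_induct)
    case (less n)
    have "(\<Sum>k\<le>n. real (n choose k) * (fact k * coeff (Q k) k))
        = (\<Sum>k\<le>n. real (n choose k) * (fdiff ^^ k) a 0)"
      using expand[of n] newton_forward[of a n] by simp
    then show ?case using less by (simp add: split)
  qed
qed

section \<open>Degrees of the coefficient polynomials\<close>

theorem theorem24:
  fixes B Q :: "nat \<Rightarrow> real poly" and a :: "nat \<Rightarrow> real"
  assumes "\<And>n. has_degree (B n) n"
    and "hyperbolicity_preserving (diff_op Q)"
    and "\<And>n. diff_op Q (B n) = smult (a n) (B n)"
    and "\<And>n. 0 < a n \<and> a n < a (Suc n)"
  shows "(\<forall>p m. interpolated_by a p \<and> has_degree p m \<longrightarrow> (\<forall>k\<le>m. has_degree (Q k) k)) \<and>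
         ((\<nexists>p. interpolated_by a p) \<longrightarrow> (\<forall>k. has_degree (Q k) k))"
proof -
  note triangular = eigenbasis_imp_triangular[OF linear_diff_op assms(1,3)]
  have degQ: "degree (Q k) \<le> k" and coeffQ: "fact k * coeff (Q k) k = (fdiff ^^ k) a 0" for k
    using triangular_coeffs[of Q a] triangular by blast+
  have "jensen_hyperbolic a"
    unfolding jensen_hyperbolic_def
    using triangular_hyperbolic_imp_jensen[OF linear_diff_op assms(2), of a] triangular assms(4)
    by (metis less_irrefl)
  then have dichotomy: "(\<forall>j. (fdiff ^^ k) a j = 0) \<or> 0 < (fdiff ^^ k) a 0" for k
    using higher_differences_pos_or_zero[of a k] assms(4) less_imp_le by blast
  have key: "\<exists>p. interpolated_by a p \<and> degree p < k" if "\<not> has_degree (Q k) k" for k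
  proof -
    have "coeff (Q k) k = 0"
      using that degQ[of k] le_degree[of "Q k" k] by (force simp: has_degree_def)
    then have zero: "(fdiff ^^ k) a j = 0" for j
      using dichotomy[of k] coeffQ[of k] by auto
    moreover have "0 < k" using zero[of 0] assms(4)[of 0] by (cases k) auto
    ultimately show ?thesis by (rule higher_differences_zero_imp_interpolated)
  qed
  show ?thesis
  proof (intro conjI allI impI)
    fix p m k
    assume p: "interpolated_by a p \<and> has_degree p m" and "k \<le> m"
    show "has_degree (Q k) k"
    proof (rule ccontr)
      assume "\<not> has_degree (Q k) k"
      then obtain q where "interpolated_by a q" "degree q < k" using key by blast
      with p have "m < k" using interpolated_by_unique by (auto simp: has_degree_def)
      with \<open>k \<le> m\<close> show False by simp
    qed
  next
    fix k
    assume "\<nexists>p. interpolated_by a p"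
    then show "has_degree (Q k) k" using key by blast
  qed
qed

end
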